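(* Let $a,b\in\mathbb{Z}$ and let $f(x)\in\mathbb{Z}[[x]]$ be the formal power series defined by $$f(x)=\frac{1}{1-ax-(b-1)x^2-x^2f(x)}.$$ Then the Riordan array $(f(x),x)$ is invariant under the $(a,b)$-process; that is, applying the $(a,b)$-process to the infinite matrix $(f(x),x)$ returns the matrix $(f(x),x)$ itself.
   Context: All matrices are infinite, integer-valued, lower-triangular, with rows and columns indexed by $1,2,3,\dots$ in the definition of the process. The $(a,b)$-process: let $M=(m_{i,j})_{i,j\ge 1}$ be a lower-triangular matrix with $1$'s on the diagonal. Form the lower-triangular matrix $\tilde M(a,b)$ whose $(i,j)$ entry is: $1$ if $i=j$; $-a$ if $i=j+1$; $-b$ if $i=j+2$; $-m_{i-2,j}$ if $i\ge j+3$; and $0$ if $i<j$. The output of the $(a,b)$-process applied to $M$ is the inverse matrix $\tilde M(a,b)^{-1}$. Riordan array: for power series $g(x)=1+g_1x+\cdots$ and $h(x)=h_1x+h_2x^2+\cdots$ with $h_1\neq 0$, $(g(x),h(x))$ denotes the infinite lower-triangular matrix whose $i$-th column (first column indexed by $0$) has generating function $g(x)h(x)^i$. In particular, if $f(x)=\sum_{n\ge0}a_nx^n$, then $(f(x),x)$ is the matrix with $(i,j)$ entry $a_{i-j}$ for $i\ge j$ and $0$ for $i<j$. The equation defining $f$ determines a unique formal power series, with constant term $1$. *)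

theory Defs
  imports "HOL-Computational_Algebra.Formal_Power_Series"
begin

text \<open>
  Infinite integer matrices are functions of a row and a column index, both starting from 0, so
  the entry in row \<open>i\<close> and column \<open>j\<close> of a matrix whose rows and columns are numbered
  \<open>1, 2, 3, \<dots>\<close> is \<open>M (i - 1) (j - 1)\<close>. The clauses defining the \<open>(a,b)\<close>-process read the
  same in both numberings, since shifting both indices by one preserves them.
\<close>

type_synonym inf_matrix = "nat \<Rightarrow> nat \<Rightarrow> int"

definition lower_triangular :: "inf_matrix \<Rightarrow> bool" where
  "lower_triangular A \<longleftrightarrow> (\<forall>i j. i < j \<longrightarrow> A i j = 0)"

definition inf_id :: inf_matrix where
  "inf_id i j = (if i = j then 1 else 0)"

text \<open>
  The matrix product, for a lower-triangular left factor: row \<open>i\<close> of \<open>A\<close> vanishes beyond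
  column \<open>i\<close>, so the sum over all \<open>k\<close> is the finite sum below.
\<close>

definition lt_mult :: "inf_matrix \<Rightarrow> inf_matrix \<Rightarrow> inf_matrix" where
  "lt_mult A B i j = (\<Sum>k\<le>i. A i k * B k j)"

definition is_lt_inverse :: "inf_matrix \<Rightarrow> inf_matrix \<Rightarrow> bool" where
  "is_lt_inverse A N \<longleftrightarrow>
     lower_triangular N \<and> lt_mult A N = inf_id \<and> lt_mult N A = inf_id"

text \<open>Meaningful for lower-triangular matrices with units on the diagonal.\<close>

definition lt_inverse :: "inf_matrix \<Rightarrow> inf_matrix" where
  "lt_inverse A = (THE N. is_lt_inverse A N)"

definition ab_tilde :: "int \<Rightarrow> int \<Rightarrow> inf_matrix \<Rightarrow> inf_matrix" where
  "ab_tilde a b M i j =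
     (if i = j then 1
      else if i = j + 1 then - a
      else if i = j + 2 then - b
      else if i \<ge> j + 3 then - M (i - 2) j
      else 0)"

text \<open>Intended for lower-triangular \<open>M\<close> with ones on the diagonal.\<close>

definition ab_process :: "int \<Rightarrow> int \<Rightarrow> inf_matrix \<Rightarrow> inf_matrix" where
  "ab_process a b M = lt_inverse (ab_tilde a b M)"

text \<open>
  The Riordan array \<open>(g, h)\<close>, intended for \<open>g\<close> with constant term 1 and \<open>h\<close> with zero constant
  term and nonzero linear coefficient.
\<close>

definition riordan :: "int fps \<Rightarrow> int fps \<Rightarrow> inf_matrix" where
  "riordan g h i j = fps_nth (g * h ^ j) i"

lemma riordan_fps_X: "riordan f fps_X i j = (if j \<le> i then fps_nth f (i - j) else 0)"
  by (simp add: riordan_def fps_X_power_mult_right_nth)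

text \<open>
  A reciprocal \<open>1 / u\<close> in the ring of integer power series is the unique \<open>v\<close> with
  \<open>v * u = 1\<close>. The equation \<open>f = 1 / (1 - a x - (b - 1) x^2 - x^2 f)\<close> is stated in this form,
  because \<^const>\<open>inverse\<close> on power series needs coefficients with a total inverse operation.
  It has exactly one solution, whose coefficients satisfy the following recurrence.
\<close>

fun ab_coeff :: "int \<Rightarrow> int \<Rightarrow> nat \<Rightarrow> int" where
  "ab_coeff a b 0 = 1"
| "ab_coeff a b (Suc 0) = a"
| "ab_coeff a b (Suc (Suc n)) = a * ab_coeff a b (Suc n) + (b - 1) * ab_coeff a b n
     + (\<Sum>k=0..n. ab_coeff a b k * ab_coeff a b (n - k))"

lemma ab_equation_iff_coeff:
  "f * (1 - fps_const a * fps_X - fps_const (b - 1) * fps_X ^ 2 - fps_X ^ 2 * f) = 1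
     \<longleftrightarrow> f = Abs_fps (ab_coeff a b)"
  (is "?eq \<longleftrightarrow> _")
proof -
  let ?R = "1 + fps_X ^ 1 * (fps_const a * f) + fps_X ^ 2 * (fps_const (b - 1) * f)
              + fps_X ^ 2 * (f * f)"
  have "?eq \<longleftrightarrow> f = ?R"
    by (auto simp: algebra_simps)
  also have "\<dots> \<longleftrightarrow> (\<forall>n. fps_nth f n = fps_nth ?R n)"
    by (simp only: fps_eq_iff)
  also have "\<dots> \<longleftrightarrow> (\<forall>n. fps_nth f n = ab_coeff a b n)"
  proof (intro iffI allI)
    fix n assume eq: "\<forall>n. fps_nth f n = fps_nth ?R n"
    show "fps_nth f n = ab_coeff a b n"
    proof (induction n rule: less_induct)
      case (less n)
      consider "n = 0" | "n = 1" | m where "n = Suc (Suc m)"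
        by (metis One_nat_def not0_implies_Suc)
      thus ?case
      proof cases
        case 3
        have "(\<Sum>k=0..m. fps_nth f k * fps_nth f (m - k))
            = (\<Sum>k=0..m. ab_coeff a b k * ab_coeff a b (m - k))"
          using 3 by (intro sum.cong) (auto simp: less)
        thus ?thesis
          using eq[rule_format, of n] less[of m] less[of "Suc m"] 3
          by (simp add: fps_X_power_mult_nth fps_mult_nth[of f f])
      qed (use eq[rule_format, of n] less[of 0] in
            \<open>simp_all add: fps_X_power_mult_nth\<close>)
    qed
  next
    fix n assume eq: "\<forall>n. fps_nth f n = ab_coeff a b n"
    show "fps_nth f n = fps_nth ?R n"
    proof (cases "(a, b, n)" rule: ab_coeff.cases)
    qed (auto simp: eq fps_X_power_mult_nth fps_mult_nth[of f f])
  qed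
  also have "\<dots> \<longleftrightarrow> f = Abs_fps (ab_coeff a b)"
    by (simp add: fps_eq_iff)
  finally show ?thesis .
qed

lemma ab_equation_unique_solution:
  fixes a b :: int
  shows "\<exists>!f. f * (1 - fps_const a * fps_X - fps_const (b - 1) * fps_X ^ 2 - fps_X ^ 2 * f) = 1"
  unfolding ab_equation_iff_coeff by simp

end

theory Submission
  imports Defs
begin

text \<open>
  The map sending a power series \<open>g\<close> to the Toeplitz matrix \<open>(g, x)\<close> is multiplicative, and for
  \<open>M = (f, x)\<close> the matrix inverted by the \<open>(a,b)\<close>-process is \<open>(u, x)\<close> with
  \<open>u = 1 - a x - (b - 1) x^2 - x^2 f\<close>: since \<open>f\<close> has constant term 1, the coefficient of \<open>x^2\<close>
  in \<open>u\<close> is \<open>-b\<close>. The defining equation \<open>f u = 1\<close> then says that \<open>(f, x)\<close> is the inverse.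
\<close>

lemma lower_triangular_riordan_fps_X: "lower_triangular (riordan g fps_X)"
  by (simp add: lower_triangular_def riordan_fps_X)

lemma riordan_1_fps_X: "riordan 1 fps_X = inf_id"
  by (auto simp: fun_eq_iff riordan_fps_X inf_id_def)

lemma lt_mult_riordan_fps_X:
  "lt_mult (riordan g fps_X) (riordan h fps_X) = riordan (g * h) fps_X"
proof (intro ext)
  fix i j
  show "lt_mult (riordan g fps_X) (riordan h fps_X) i j = riordan (g * h) fps_X i j"
  proof (cases "j \<le> i")
    case True
    have "lt_mult (riordan g fps_X) (riordan h fps_X) i j
        = (\<Sum>k=j..i. fps_nth g (i - k) * fps_nth h (k - j))"
      unfolding lt_mult_def by (intro sum.mono_neutral_cong_right) (auto simp: riordan_fps_X)
    \<comment> \<open>The substitution \<open>k\<close> to \<open>i - k\<close> turns the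
      row-by-column sum into a Cauchy product.\<close>
    also have "\<dots> = (\<Sum>k=0..i - j. fps_nth g k * fps_nth h (i - j - k))"
      by (intro sum.reindex_bij_witness[of _ "\<lambda>k. i - k" "\<lambda>k. i - k"])
         (use True in \<open>auto simp: add.commute\<close>)
    finally show ?thesis
      using True by (simp add: riordan_fps_X fps_mult_nth)
  qed (auto simp: lt_mult_def riordan_fps_X intro!: sum.neutral)
qed

lemma lt_mult_id_left: "lt_mult inf_id A = A"
  by (auto simp: fun_eq_iff lt_mult_def inf_id_def if_distrib[of "\<lambda>x. x * _"] cong: if_cong)

text \<open>The sum stops at \<open>k = i\<close>, so entries with \<open>j > i\<close> come out as
  0; triangularity makes \<open>A\<close> agree there.\<close>

lemma lt_mult_id_right:
  assumes "lower_triangular A"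
  shows "lt_mult A inf_id = A"
  using assms
  by (auto simp: fun_eq_iff lt_mult_def inf_id_def lower_triangular_def if_distrib[of "\<lambda>x. _ * x"]
           cong: if_cong)

lemma lt_mult_assoc:
  assumes "lower_triangular B"
  shows "lt_mult (lt_mult A B) C = lt_mult A (lt_mult B C)"
proof (intro ext)
  fix i j
  \<comment> \<open>Padding with zero entries of \<open>B\<close> makes the inner range independent
    of \<open>l\<close>, so the two sums can be swapped.\<close>
  have "(\<Sum>k\<le>l. B l k * C k j) = (\<Sum>k\<le>i. B l k * C k j)" if "l \<le> i" for l
    by (rule sum.mono_neutral_left) (use assms that in \<open>auto simp: lower_triangular_def\<close>)
  hence "lt_mult A (lt_mult B C) i j = (\<Sum>l\<le>i. \<Sum>k\<le>i. A i l * B l k * C k j)"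
    by (simp add: lt_mult_def sum_distrib_left mult.assoc)
  also have "\<dots> = lt_mult (lt_mult A B) C i j"
    unfolding lt_mult_def sum_distrib_right by (rule sum.swap)
  finally show "lt_mult (lt_mult A B) C i j = lt_mult A (lt_mult B C) i j" ..
qed

text \<open>Uniqueness for \<open>THE\<close> is the monoid argument
  \<open>N' = N' (A N) = (N' A) N = N\<close>; associativity uses that the middle factor
  \<open>A\<close> is triangular.\<close>

lemma lt_inverse_eqI:
  assumes "lower_triangular A" "is_lt_inverse A N"
  shows "lt_inverse A = N"
  unfolding lt_inverse_def
proof (rule the_equality)
  fix N' assume N': "is_lt_inverse A N'"
  hence "N' = lt_mult N' (lt_mult A N)"
    using assms by (simp add: is_lt_inverse_def lt_mult_id_right)
  also have "\<dots> = lt_mult (lt_mult N' A) N"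
    using assms by (simp add: lt_mult_assoc)
  also have "\<dots> = N"
    using N' by (simp add: is_lt_inverse_def lt_mult_id_left)
  finally show "N' = N" .
qed (fact assms)

lemma ab_tilde_riordan_fps_X:
  assumes "fps_nth f 0 = 1"
  shows "ab_tilde a b (riordan f fps_X)
    = riordan (1 - fps_const a * fps_X - fps_const (b - 1) * fps_X ^ 2 - fps_X ^ 2 * f) fps_X"
  (is "_ = riordan ?u fps_X")
proof (intro ext)
  fix i j
  have nth: "fps_nth ?u n = (if n = 0 then 1 else if n = 1 then - a else if n = 2 then - b
      else - fps_nth f (n - 2))" for n
    using assms by (auto simp: fps_X_power_mult_nth fps_X_power_nth)
  show "ab_tilde a b (riordan f fps_X) i j = riordan ?u fps_X i j"
    \<comment> \<open>Below the second subdiagonal, the row shift \<open>i - 2\<close> in the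
      process matches the factor \<open>x^2\<close> before \<open>f\<close>:
      \<open>i - 2 - j = i - j - 2\<close>.\<close>
    unfolding ab_tilde_def riordan_fps_X nth by (auto simp: diff_right_commute)
qed

theorem proposition2:
  fixes a b :: int and f :: "int fps"
  assumes "f * (1 - fps_const a * fps_X - fps_const (b - 1) * fps_X ^ 2 - fps_X ^ 2 * f) = 1"
  shows "ab_process a b (riordan f fps_X) = riordan f fps_X"
proof -
  let ?u = "1 - fps_const a * fps_X - fps_const (b - 1) * fps_X ^ 2 - fps_X ^ 2 * f"
  have "fps_nth f 0 = 1"
    using assms by (simp add: ab_equation_iff_coeff)
  moreover have "is_lt_inverse (riordan ?u fps_X) (riordan f fps_X)"
    \<comment> \<open>Power series commute, so the single equation \<open>f * ?u = 1\<close> settles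
      both one-sided inverse conditions.\<close>
    unfolding is_lt_inverse_def lt_mult_riordan_fps_X mult.commute[of ?u f] assms
    by (simp add: lower_triangular_riordan_fps_X riordan_1_fps_X)
  ultimately show ?thesis
    by (simp add: ab_process_def ab_tilde_riordan_fps_X lt_inverse_eqI
        lower_triangular_riordan_fps_X)
qed

end
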